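(* For every infinite cardinal $\kappa$, $\mathbb B(2^\kappa)\nrightarrow(2)^{\mathrm{FS}}_\kappa$; that is, there is a colouring $c:\mathbb B(2^\kappa)\to\kappa$ such that there are no two distinct elements $x,y\in\mathbb B(2^\kappa)$ with $c(x)=c(y)=c(x+y)$.
   Context: For an infinite cardinal $\lambda$, $\mathbb B(\lambda)$ denotes the Boolean group (every nonzero element has order $2$) of cardinality $\lambda$, unique up to isomorphism; concretely it is $([\lambda]^{<\omega},\triangle)$, the finite subsets of $\lambda$ under symmetric difference. *)

theory Defs
  imports "HOL-Algebra.Algebra"
begin

unbundle cardinal_syntax

text \<open>Cardinals are represented as in the HOL cardinal library, by relations satisfying
  \<^const>\<open>Card_order\<close>; the underlying set of a cardinal is its \<^const>\<open>Field\<close>.\<close>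

definition Boolean_group :: "'a rel \<Rightarrow> 'a set monoid" (\<open>\<bool>\<close>) where
  "\<bool> \<mu> = \<lparr>carrier = Fpow (Field \<mu>), monoid.mult = sym_diff, one = {}\<rparr>"

text \<open>The group operation is written multiplicatively, so the finite sums
  are values of \<^const>\<open>finprod\<close>.\<close>

definition FS :: "('g, 'm) monoid_scheme \<Rightarrow> 'g set \<Rightarrow> 'g set" where
  "FS G A = {finprod G (\<lambda>x. x) F | F. F \<subseteq> A \<and> finite F \<and> F \<noteq> {}}"

text \<open>The partition relation written \<open>G --> (n)^FS_\<kappa>\<close> for finite \<open>n\<close>.\<close>

definition FS_arrow :: "('g, 'm) monoid_scheme \<Rightarrow> nat \<Rightarrow> 'k rel \<Rightarrow> bool" where
  "FS_arrow G n \<kappa> \<longleftrightarrow>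
     (\<forall>c \<in> carrier G \<rightarrow> Field \<kappa>.
        \<exists>A \<subseteq> carrier G. finite A \<and> card A = n \<and> (\<exists>i \<in> Field \<kappa>. \<forall>s \<in> FS G A. c s = i))"

lemma comm_group_Boolean_group: "comm_group (\<bool> \<mu>)"
proof (rule comm_groupI)
  fix x assume "x \<in> carrier (\<bool> \<mu>)"
  then show "\<exists>y\<in>carrier (\<bool> \<mu>). y \<otimes>\<^bsub>\<bool> \<mu>\<^esub> x = \<one>\<^bsub>\<bool> \<mu>\<^esub>"
    by (intro bexI[of _ x]) (auto simp: Boolean_group_def)
qed (auto simp: Boolean_group_def Fpow_def)

lemma Boolean_group_square: "x \<otimes>\<^bsub>\<bool> \<mu>\<^esub> x = \<one>\<^bsub>\<bool> \<mu>\<^esub>"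
  by (simp add: Boolean_group_def)

lemma card_Boolean_group:
  assumes "Cinfinite \<mu>"
  shows "|carrier (\<bool> \<mu>)| =o \<mu>"
proof -
  have "|Fpow (Field \<mu>)| =o |Field \<mu>|"
    using assms by (simp add: cinfinite_def)
  also have "|Field \<mu>| =o \<mu>"
    using assms by (simp add: card_of_Field_ordIso)
  finally show ?thesis by (simp add: Boolean_group_def)
qed

lemma FS_pair:
  assumes "comm_group G" "x \<in> carrier G" "y \<in> carrier G" "x \<noteq> y"
  shows "FS G {x, y} = {x, y, x \<otimes>\<^bsub>G\<^esub> y}"
proof -
  interpret comm_group G by fact
  have "{F. F \<subseteq> {x, y} \<and> finite F \<and> F \<noteq> {}} = {{x}, {y}, {x, y}}"
    by (auto intro: finite_subset)
  then have "FS G {x, y} = finprod G (\<lambda>x. x) ` {{x}, {y}, {x, y}}"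
    unfolding FS_def by blast
  then show ?thesis using assms by simp
qed

end

theory Submission
  imports Defs
begin

text \<open>View the elements of the group as finite sets of functions from \<open>\<kappa>\<close> to \<open>2\<close>. For each
  basic clopen set \<open>U\<close> of \<open>2\<^sup>\<kappa>\<close>, the parity of \<open>|x \<inter> U|\<close> is additive in \<open>x\<close>, so \<open>x\<close>, \<open>y\<close>
  and \<open>x + y\<close> cannot all have odd parity. Colour a nonempty \<open>x\<close> by a \<open>U\<close> that isolates one of its
  points, and the empty set by a code of the empty clopen set; there are only \<open>\<kappa>\<close> such codes.\<close>

lemma even_card_sym_diff_iff:
  assumes "finite A" "finite B"
  shows "even (card (sym_diff A B)) \<longleftrightarrow> (even (card A) \<longleftrightarrow> even (card B))"
proof -
  have "card (sym_diff A B) = card (A - B) + card (B - A)"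
    using assms by (intro card_Un_disjoint) auto
  moreover have "card A = card (A \<inter> B) + card (A - B)" "card B = card (A \<inter> B) + card (B - A)"
    using card_Int_Diff[OF assms(1), of B] card_Int_Diff[OF assms(2), of A]
    by (simp_all add: Int_commute)
  ultimately show ?thesis by auto
qed

text \<open>A basic clopen set of \<open>2\<^sup>\<kappa>\<close> if \<open>t \<subseteq> s\<close>, and empty otherwise.\<close>

definition cylinder :: "'a set \<Rightarrow> 'a set \<Rightarrow> ('a \<Rightarrow> bool) set" where
  "cylinder s t = {f. {a \<in> s. f a} = t}"

text \<open>Each \<open>g\<close> in \<open>x\<close> other than \<open>f\<close> differs from
  \<open>f\<close> at some coordinate in \<open>K\<close>. Picking one such coordinate per
  \<open>g\<close> gives a finite \<open>s\<close>, and no \<open>g\<close> other than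
  \<open>f\<close> agrees with \<open>f\<close> on all of \<open>s\<close>.\<close>

lemma isolating_cylinder:
  assumes "finite x" "x \<subseteq> Func K UNIV" "f \<in> x"
  obtains s where "s \<in> Fpow K" "x \<inter> cylinder s {a \<in> s. f a} = {f}"
proof -
  have "\<exists>a\<in>K. f a \<noteq> g a" if "g \<in> x - {f}" for g
  proof (rule ccontr)
    assume "\<not> ?thesis"
    moreover have "f \<in> Func K UNIV" "g \<in> Func K UNIV" using assms that by auto
    \<comment> \<open>Members of \<open>Func K UNIV\<close> all take the value
      \<open>undefined\<close> outside \<open>K\<close>, so agreement on \<open>K\<close> is
      equality.\<close>
    ultimately have "f a = g a" for a by (cases "a \<in> K") (simp_all add: Func_def)
    then show False using that by auto
  qed
  then obtain d where d: "\<And>g. g \<in> x - {f} \<Longrightarrow> d g \<in> K \<and> f (d g) \<noteq> g (d g)"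
    by metis
  show thesis
  proof
    show "d ` (x - {f}) \<in> Fpow K" using d assms(1) by (auto simp: Fpow_def)
    show "x \<inter> cylinder (d ` (x - {f})) {a \<in> d ` (x - {f}). f a} = {f}"
      using d assms(3) by (fastforce simp: cylinder_def)
  qed
qed

text \<open>The second alternative is forced: the empty set meets every cylinder in an even number
  of points. Requiring its cylinder to be empty separates its colour from that of any nonempty
  \<open>x\<close>.\<close>

lemma odd_cylinder_colouring:
  fixes K :: "'a set"
  assumes "K \<noteq> {}"
  obtains col :: "('a \<Rightarrow> bool) set \<Rightarrow> 'a set \<times> 'a set" where
    "col \<in> Fpow (Func K UNIV) \<rightarrow> Fpow K \<times> Fpow K"
    "\<And>x. x \<in> Fpow (Func K UNIV) \<Longrightarrow>
      odd (card (x \<inter> case_prod cylinder (col x))) \<or> case_prod cylinder (col x) = {} \<and> x = {}"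
proof -
  have "\<exists>p \<in> Fpow K \<times> Fpow K.
      odd (card (x \<inter> case_prod cylinder p)) \<or> case_prod cylinder p = {} \<and> x = {}"
    if x: "x \<in> Fpow (Func K UNIV)" for x :: "('a \<Rightarrow> bool) set"
  proof (cases "x = {}")
    case True
    obtain a where "a \<in> K" using assms by blast
    \<comment> \<open>No subset of \<open>{}\<close> equals \<open>{a}\<close>, so the code
      \<open>({}, {a})\<close> describes the empty cylinder.\<close>
    then show ?thesis using True
      by (intro bexI[of _ "({}, {a})"]) (auto simp: Fpow_def cylinder_def)
  next
    case False
    then obtain f where f: "f \<in> x" by blast
    from x f obtain s where s: "s \<in> Fpow K" "x \<inter> cylinder s {a \<in> s. f a} = {f}"
      using isolating_cylinder[of x K f] unfolding Fpow_def by blast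
    show ?thesis
      by (intro bexI[of _ "(s, {a \<in> s. f a})"]) (use s in \<open>auto simp: Fpow_def\<close>)
  qed
  then show thesis using that by (metis (no_types, lifting) Pi_I)
qed

text \<open>This bounds the number of cylinder codes, so that they can be injected into the colour
  set.\<close>

lemma Fpow_Times_Fpow_ordLeq:
  assumes "Cinfinite \<kappa>"
  shows "|Fpow (Field \<kappa>) \<times> Fpow (Field \<kappa>)| \<le>o |Field \<kappa>|"
proof -
  have inf: "infinite (Field \<kappa>)" using assms by (simp add: cinfinite_def)
  then have F: "|Fpow (Field \<kappa>)| =o |Field \<kappa>|" by simp
  then have "infinite (Fpow (Field \<kappa>))" using inf by (metis card_of_ordIso_finite)
  then have "|Fpow (Field \<kappa>) \<times> Fpow (Field \<kappa>)| =o |Fpow (Field \<kappa>)|"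
    by (rule card_of_Times_same_infinite)
  with F show ?thesis by (metis ordIso_transitive ordIso_imp_ordLeq)
qed

lemma Boolean_group_FS_colouring:
  fixes \<kappa> :: "'k rel"
  assumes "Cinfinite \<kappa>"
  obtains c where "c \<in> carrier (\<bool> (ctwo ^c \<kappa>)) \<rightarrow> Field \<kappa>"
    "\<And>x y. x \<in> carrier (\<bool> (ctwo ^c \<kappa>)) \<Longrightarrow> y \<in> carrier (\<bool> (ctwo ^c \<kappa>)) \<Longrightarrow> x \<noteq> y \<Longrightarrow>
      c x = c y \<Longrightarrow> c y \<noteq> c (x \<otimes>\<^bsub>\<bool> (ctwo ^c \<kappa>)\<^esub> y)"
proof -
  define K where "K = Field \<kappa>"
  \<comment> \<open>\<open>ctwo ^c \<kappa>\<close> is by definition the cardinal of a set of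
    boolean functions, and its field is that very set; no transfer along a bijection is
    needed.\<close>
  have carr: "carrier (\<bool> (ctwo ^c \<kappa>)) = Fpow (Func K UNIV)"
    by (simp add: Boolean_group_def cexp_def ctwo_def K_def)
  have "K \<noteq> {}" using assms by (auto simp: cinfinite_def K_def)
  obtain col where col: "col \<in> Fpow (Func K UNIV) \<rightarrow> Fpow K \<times> Fpow K"
    and odd: "\<And>x. x \<in> Fpow (Func K UNIV) \<Longrightarrow>
      odd (card (x \<inter> case_prod cylinder (col x))) \<or> case_prod cylinder (col x) = {} \<and> x = {}"
    using odd_cylinder_colouring[OF \<open>K \<noteq> {}\<close>] by blast
  obtain h where h: "inj_on h (Fpow K \<times> Fpow K)" "h ` (Fpow K \<times> Fpow K) \<subseteq> K"
    using Fpow_Times_Fpow_ordLeq[OF assms] unfolding K_def card_of_ordLeq[symmetric] by blast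
  have col_eq: "col x = col y"
    if "x \<in> Fpow (Func K UNIV)" "y \<in> Fpow (Func K UNIV)" "h (col x) = h (col y)" for x y
    using inj_onD[OF h(1) that(3)] that col by blast
  show thesis
  proof
    show "h \<circ> col \<in> carrier (\<bool> (ctwo ^c \<kappa>)) \<rightarrow> Field \<kappa>"
      unfolding carr K_def[symmetric]
    proof
      fix x :: "('k \<Rightarrow> bool) set"
      assume "x \<in> Fpow (Func K UNIV)"
      with col have "col x \<in> Fpow K \<times> Fpow K" by (rule Pi_mem)
      then show "(h \<circ> col) x \<in> K" unfolding comp_apply by (rule subsetD[OF h(2) imageI])
    qed
  next
    fix x y
    assume xy: "x \<in> carrier (\<bool> (ctwo ^c \<kappa>))" "y \<in> carrier (\<bool> (ctwo ^c \<kappa>))" "x \<noteq> y"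
      and eq: "(h \<circ> col) x = (h \<circ> col) y"
    show "(h \<circ> col) y \<noteq> (h \<circ> col) (x \<otimes>\<^bsub>\<bool> (ctwo ^c \<kappa>)\<^esub> y)"
    proof
      assume "(h \<circ> col) y = (h \<circ> col) (x \<otimes>\<^bsub>\<bool> (ctwo ^c \<kappa>)\<^esub> y)"
      then have eq': "h (col y) = h (col (sym_diff x y))" by (simp add: Boolean_group_def)
      have fin: "x \<in> Fpow (Func K UNIV)" "y \<in> Fpow (Func K UNIV)"
        "sym_diff x y \<in> Fpow (Func K UNIV)"
        using xy by (auto simp: carr Fpow_def)
      define U where "U = case_prod cylinder (col x)"
      have "col y = col x" "col (sym_diff x y) = col x"
        using col_eq fin eq eq' by (metis comp_apply)+
      then have U: "z \<in> {x, y, sym_diff x y} \<Longrightarrow> odd (card (z \<inter> U)) \<or> U = {} \<and> z = {}" for z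
        using odd fin unfolding U_def by (metis insertE singletonD)
      \<comment> \<open>If \<open>U\<close> were empty, no intersection with it would be odd, which
        would leave \<open>x = {} = y\<close>.\<close>
      have "U \<noteq> {}" using U[of x] U[of y] xy(3) by auto
      then have "odd (card (x \<inter> U))" "odd (card (y \<inter> U))" "odd (card (sym_diff x y \<inter> U))"
        using U by blast+
      moreover have "sym_diff x y \<inter> U = sym_diff (x \<inter> U) (y \<inter> U)" by blast
      ultimately show False
        using even_card_sym_diff_iff[of "x \<inter> U" "y \<inter> U"] fin by (simp add: Fpow_def)
    qed
  qed
qed

theorem theorem4p1:
  fixes \<kappa> :: "'k rel"
  assumes "Cinfinite \<kappa>"
  shows "\<not> FS_arrow (\<bool> (ctwo ^c \<kappa>)) 2 \<kappa> \<and>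
    (\<exists>c \<in> carrier (\<bool> (ctwo ^c \<kappa>)) \<rightarrow> Field \<kappa>.
       \<not> (\<exists>x \<in> carrier (\<bool> (ctwo ^c \<kappa>)). \<exists>y \<in> carrier (\<bool> (ctwo ^c \<kappa>)).
            x \<noteq> y \<and> c x = c y \<and> c y = c (x \<otimes>\<^bsub>\<bool> (ctwo ^c \<kappa>)\<^esub> y)))"
proof -
  let ?G = "\<bool> (ctwo ^c \<kappa>)"
  obtain c where c: "c \<in> carrier ?G \<rightarrow> Field \<kappa>"
    and no: "\<And>x y. x \<in> carrier ?G \<Longrightarrow> y \<in> carrier ?G \<Longrightarrow> x \<noteq> y \<Longrightarrow> c x = c y \<Longrightarrow>
      c y \<noteq> c (x \<otimes>\<^bsub>?G\<^esub> y)"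
    using Boolean_group_FS_colouring[OF assms] by blast
  have "\<not> FS_arrow ?G 2 \<kappa>"
  proof
    assume "FS_arrow ?G 2 \<kappa>"
    then obtain A i where A: "A \<subseteq> carrier ?G" "card A = 2" "\<forall>s \<in> FS ?G A. c s = i"
      using c unfolding FS_arrow_def by blast
    from A(2) obtain x y where xy: "A = {x, y}" "x \<noteq> y" by (auto simp: card_2_iff)
    \<comment> \<open>For two distinct elements the finite sums are just the elements and their
      product, so a constant colour on them is what \<open>no\<close> excludes.\<close>
    have "FS ?G A = {x, y, x \<otimes>\<^bsub>?G\<^esub> y}"
      unfolding xy(1) using A(1) xy by (intro FS_pair comm_group_Boolean_group) auto
    then show False using A(1,3) xy no[of x y] by simp
  qed
  with c no show ?thesis by blast
qed

end
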